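(* For $n\ge 1$ let $l_n$ be the largest even positive integer with exactly $n$ digits in base $3/2$, and let $a(m)$, $m\ge 0$, be the characteristic sequence of the greedy partition of the nonnegative integers into sequences $T_0,T_1,T_2,\ldots$ containing no 3-term arithmetic progression. Then, for all $n\ge 1$, $l_n=2\,a(3^n-1)$. (The sequence $n\mapsto a(3^n-1)$ is OEIS sequence A006999.)
   Context: The base-$3/2$ representation of a nonnegative integer $m$ is obtained as follows ("exploding dots"): place $m$ dots in the rightmost box of a row of boxes extending infinitely to the left; whenever a box contains at least three dots, remove three dots from it and place two dots in the box immediately to its left; continue until every box contains $0$, $1$ or $2$ dots. The numbers of dots, read from left to right starting with the leftmost nonempty box, are the digits of $m$ in base $3/2$ (the representation of $0$ is $0$). The sequence $l_n$ in base ten begins $2,4,8,14,22,34,52,80,\ldots$. Greedy partition: $T_0$ is the lexicographically earliest increasing (infinite) sequence of nonnegative integers containing no three terms in (nonconstant) arithmetic progression: $0,1,3,4,9,10,12,\ldots$. For $k\ge1$, $T_k$ is the lexicographically earliest increasing sequence, containing no three terms in arithmetic progression, formed from the nonnegative integers not belonging to $T_0\cup\cdots\cup T_{k-1}$; thus $T_1=2,5,6,11,14,15,\ldots$ and $T_2=7,8,16,17,19,20,\ldots$. The characteristic sequence $a$ is defined by $a(m)=k$ when $m\in T_k$; it begins $0,0,1,0,0,1,1,2,2,0,0,\ldots$ (OEIS A006997). *)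

theory Defs
  imports "HOL-Library.Infinite_Set"
begin

text \<open>A row of boxes is a function \<open>c\<close> with \<open>c i\<close> the number of dots in box \<open>i\<close>;
  boxes are numbered from right to left, and box \<open>0\<close> is the rightmost one.\<close>

definition initial_boxes :: "nat \<Rightarrow> nat \<Rightarrow> nat" where
  "initial_boxes m = (\<lambda>i. if i = 0 then m else 0)"

inductive explode :: "(nat \<Rightarrow> nat) \<Rightarrow> (nat \<Rightarrow> nat) \<Rightarrow> bool" where
  "3 \<le> c i \<Longrightarrow> explode c (c(i := c i - 3, Suc i := c (Suc i) + 2))"

definition settled :: "(nat \<Rightarrow> nat) \<Rightarrow> bool" where
  "settled c \<longleftrightarrow> (\<forall>i. c i \<in> {0, 1, 2})"

definition final_boxes :: "nat \<Rightarrow> nat \<Rightarrow> nat" where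
  "final_boxes m = (THE c. explode\<^sup>*\<^sup>* (initial_boxes m) c \<and> settled c)"

definition digits32 :: "nat \<Rightarrow> nat list" where
  "digits32 m = (if m = 0 then [0]
     else map (final_boxes m) (rev [0..<Suc (Max {i. final_boxes m i \<noteq> 0})]))"

definition largest_even :: "nat \<Rightarrow> nat" where
  "largest_even n = (GREATEST m. even m \<and> 0 < m \<and> length (digits32 m) = n)"

text \<open>The explosion process terminates, and its result does not depend on the order of the
  explosions, so the description in \<open>final_boxes\<close> is proper.\<close>

lemma settled_not_explode:
  assumes "settled c" shows "\<not> explode c d"
proof
  assume "explode c d"
  then obtain i where "3 \<le> c i" by cases
  then show False using assms by (auto simp: settled_def dest: spec[of _ i])
qed

lemma explode_diamond:
  assumes "explode c c1" "explode c c2" "c1 \<noteq> c2"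
  shows "\<exists>d. explode c1 d \<and> explode c2 d"
proof -
  from assms(1) obtain i where i: "3 \<le> c i" "c1 = c(i := c i - 3, Suc i := c (Suc i) + 2)"
    by cases
  from assms(2) obtain j where j: "3 \<le> c j" "c2 = c(j := c j - 3, Suc j := c (Suc j) + 2)"
    by cases
  have "i \<noteq> j" using i j assms(3) by auto
  let ?d1 = "c1(j := c1 j - 3, Suc j := c1 (Suc j) + 2)"
  let ?d2 = "c2(i := c2 i - 3, Suc i := c2 (Suc i) + 2)"
  have "explode c1 ?d1" using i j \<open>i \<noteq> j\<close> by (intro explode.intros) auto
  moreover have "explode c2 ?d2" using i j \<open>i \<noteq> j\<close> by (intro explode.intros) auto
  moreover have "?d1 = ?d2" using i j \<open>i \<noteq> j\<close> by (auto simp: fun_eq_iff)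
  ultimately show ?thesis by metis
qed

lemma explode_strip:
  assumes "explode\<^sup>*\<^sup>* c d" "explode c c'" "settled d"
  shows "explode\<^sup>*\<^sup>* c' d"
  using assms
proof (induction arbitrary: c' rule: converse_rtranclp_induct)
  case base
  then show ?case using settled_not_explode by blast
next
  case (step c e)
  show ?case
  proof (cases "e = c'")
    case False
    then obtain f where "explode e f" "explode c' f"
      using explode_diamond step.hyps(1) step.prems(1) by blast
    then show ?thesis using step.IH step.prems(2) by (meson converse_rtranclp_into_rtranclp)
  qed (use step in simp)
qed

lemma explode_unique:
  assumes "explode\<^sup>*\<^sup>* c d" "explode\<^sup>*\<^sup>* c e" "settled d" "settled e"
  shows "d = e"
  using assms
proof (induction arbitrary: e rule: converse_rtranclp_induct)
  case base
  from base(1) show ?case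
    by (cases rule: converse_rtranclpE)
      (use base(2) settled_not_explode in blast)+
next
  case (step c f)
  then show ?case using explode_strip by metis
qed

lemma explode_terminates:
  assumes "finite {i. c i \<noteq> 0}"
  shows "\<exists>d. explode\<^sup>*\<^sup>* c d \<and> settled d"
  using assms
proof (induction "\<Sum>i | c i \<noteq> 0. c i" arbitrary: c rule: less_induct)
  case less
  show ?case
  proof (cases "settled c")
    case False
    have "settled c" if "\<And>i. c i < 3"
      unfolding settled_def using that by (auto simp: numeral_3_eq_3 less_Suc_eq numeral_2_eq_2)
    with False obtain i where i: "3 \<le> c i" by (meson not_le)
    let ?c = "c(i := c i - 3, Suc i := c (Suc i) + 2)"
    have explode_c: "explode c ?c" using i by (rule explode.intros)
    let ?S = "insert i (insert (Suc i) {j. c j \<noteq> 0})"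
    have fin: "finite ?S" using less.prems by simp
    have sub: "{j. ?c j \<noteq> 0} \<subseteq> ?S" by auto
    have A: "(\<Sum>j | ?c j \<noteq> 0. ?c j) = sum ?c ?S"
      by (rule sum.mono_neutral_left[OF fin sub]) auto
    have B: "(\<Sum>j | c j \<noteq> 0. c j) = sum c ?S"
      by (rule sum.mono_neutral_left[OF fin]) auto
    let ?R = "?S - {i} - {Suc i}"
    have C: "sum f ?S = f i + (f (Suc i) + sum f ?R)" for f :: "nat \<Rightarrow> nat"
      using fin by (subst sum.remove[of _ i]) (simp, simp, subst sum.remove[of _ "Suc i"], auto)
    have "sum ?c ?R = sum c ?R" by (rule sum.cong) auto
    then have "sum ?c ?S < sum c ?S" unfolding C using i by simp
    moreover have "finite {j. ?c j \<noteq> 0}" using finite_subset[OF sub fin] .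
    ultimately obtain d where "explode\<^sup>*\<^sup>* ?c d" "settled d"
      using less.hyps[of ?c] A B by metis
    then show ?thesis using explode_c by (meson converse_rtranclp_into_rtranclp)
  qed auto
qed

lemma ex1_final_boxes: "\<exists>!c. explode\<^sup>*\<^sup>* (initial_boxes m) c \<and> settled c"
proof -
  have "{i. initial_boxes m i \<noteq> 0} \<subseteq> {0}" by (auto simp: initial_boxes_def)
  then have "finite {i. initial_boxes m i \<noteq> 0}" using finite_subset by blast
  then show ?thesis using explode_terminates explode_unique by blast
qed

definition ap3_free :: "nat set \<Rightarrow> bool" where
  "ap3_free S \<longleftrightarrow> \<not> (\<exists>b d. 0 < d \<and> b \<in> S \<and> b + d \<in> S \<and> b + 2 * d \<in> S)"

definition admissible :: "nat set \<Rightarrow> (nat \<Rightarrow> nat) \<Rightarrow> bool" where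
  "admissible A s \<longleftrightarrow> strict_mono s \<and> range s \<subseteq> A \<and> ap3_free (range s)"

definition lex_less :: "(nat \<Rightarrow> nat) \<Rightarrow> (nat \<Rightarrow> nat) \<Rightarrow> bool" where
  "lex_less s t \<longleftrightarrow> (\<exists>i. (\<forall>j<i. s j = t j) \<and> s i < t i)"

definition earliest :: "nat set \<Rightarrow> nat \<Rightarrow> nat" where
  "earliest A = (THE s. admissible A s \<and> (\<forall>t. admissible A t \<and> t \<noteq> s \<longrightarrow> lex_less s t))"

text \<open>The lexicographically earliest sequence is unique, and it exists in every infinite set.\<close>

lemma lex_less_antisym: "lex_less s t \<Longrightarrow> \<not> lex_less t s"
  unfolding lex_less_def by (metis linorder_neqE_nat not_less_iff_gr_or_eq)

lemma admissible_exists: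
  assumes "infinite A"
  shows "\<exists>s. admissible A s"
proof -
  have "\<exists>f. \<forall>n. f n \<in> A \<and> 2 * f n < f (Suc n)"
    by (rule dependent_nat_choice) (use assms infinite_nat_iff_unbounded in blast)+
  then obtain f where f: "\<And>n. f n \<in> A" "\<And>n. 2 * f n < f (Suc n)" by blast
  have mono: "strict_mono f"
    unfolding strict_mono_Suc_iff by (metis f(2) le_add2 le_less_trans mult_2)
  have "ap3_free (range f)"
    unfolding ap3_free_def
  proof safe
    fix b d i j k
    assume "0 < d" and eq: "b + d = f j" "b + 2 * d = f k"
    then have "f j < f k" by simp
    then have "f (Suc j) \<le> f k" using mono by (simp add: strict_mono_less strict_mono_less_eq)
    with f(2)[of j] eq show False by simp
  qed
  then show ?thesis using mono f(1) unfolding admissible_def by blast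
qed

lemma ex1_earliest:
  assumes "infinite A"
  shows "\<exists>!s. admissible A s \<and> (\<forall>t. admissible A t \<and> t \<noteq> s \<longrightarrow> lex_less s t)"
proof -
  define P where "P x n v \<longleftrightarrow> (\<exists>s. admissible A s \<and> (\<forall>j<n. s j = x j) \<and> s n = v)"
    for x :: "nat \<Rightarrow> nat" and n v
  have "P x n = P y n" if "\<And>j. j < n \<Longrightarrow> x j = y j" for x y n
  proof -
    have "(\<forall>j<n. s j = x j) \<longleftrightarrow> (\<forall>j<n. s j = y j)" for s using that by metis
    then show ?thesis unfolding P_def by (intro ext) metis
  qed
  then have cong: "(r = (LEAST v. P f n v)) = (r = (LEAST v. P g n v))"
    if "\<And>j. (j, n) \<in> less_than \<Longrightarrow> f j = g j" for f g n r
    using that by (metis less_than_iff)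
  have "\<exists>x. \<forall>n. x n = (LEAST v. P x n v)"
    by (rule dependent_wf_choice[of less_than "\<lambda>x n r. r = (LEAST v. P x n v)", OF wf_less_than])
      (erule cong, blast)
  then obtain x where x: "\<And>n. x n = (LEAST v. P x n v)" by blast
  have pre: "\<exists>s. admissible A s \<and> (\<forall>j<n. s j = x j)" for n
  proof (induction n)
    case (Suc n)
    then obtain v where "P x n v" unfolding P_def by blast
    then have "P x n (x n)" unfolding x[of n] by (rule LeastI)
    then show ?case unfolding P_def by (metis less_Suc_eq)
  qed (use admissible_exists[OF assms] in simp)
  have least: "lex_less x t" if t: "admissible A t" "t \<noteq> x" for t
  proof -
    define i where "i = (LEAST i. t i \<noteq> x i)"
    have "\<exists>i. t i \<noteq> x i" using t(2) by auto
    then have i: "t i \<noteq> x i" unfolding i_def by (rule LeastI_ex)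
    have j: "\<And>j. j < i \<Longrightarrow> t j = x j" unfolding i_def using not_less_Least by blast
    have "P x i (t i)" unfolding P_def using t(1) j by blast
    then have "x i \<le> t i" unfolding x[of i] by (rule Least_le)
    with i j show ?thesis unfolding lex_less_def by (metis le_neq_implies_less)
  qed
  have "strict_mono x" unfolding strict_mono_Suc_iff
  proof
    fix n
    obtain s where "admissible A s" "\<forall>j<Suc (Suc n). s j = x j" using pre by blast
    then show "x n < x (Suc n)" unfolding admissible_def strict_mono_Suc_iff
      by (metis lessI less_SucI)
  qed
  moreover have "range x \<subseteq> A"
  proof safe
    fix n
    obtain s where "admissible A s" "\<forall>j<Suc n. s j = x j" using pre by blast
    then show "x n \<in> A" unfolding admissible_def by (metis lessI range_subsetD)
  qed
  moreover have "ap3_free (range x)"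
  proof (rule ccontr)
    assume "\<not> ap3_free (range x)"
    then obtain b d i j k where "0 < d" and eq: "b = x i" "b + d = x j" "b + 2 * d = x k"
      unfolding ap3_free_def by blast
    obtain s where s: "admissible A s" "\<forall>m<Suc (i + j + k). s m = x m" using pre by blast
    then have "s i = x i" "s j = x j" "s k = x k" by auto
    then have "b \<in> range s" "b + d \<in> range s" "b + 2 * d \<in> range s"
      using eq by (metis rangeI)+
    with s(1) \<open>0 < d\<close> show False unfolding admissible_def ap3_free_def by blast
  qed
  ultimately have "admissible A x" unfolding admissible_def by blast
  with least lex_less_antisym show ?thesis by metis
qed

fun used :: "nat \<Rightarrow> nat set" where
  "used 0 = {}"
| "used (Suc k) = used k \<union> range (earliest (- used k))"

definition greedy_seq :: "nat \<Rightarrow> nat \<Rightarrow> nat" where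
  "greedy_seq k = earliest (- used k)"

definition greedy_class :: "nat \<Rightarrow> nat" where
  "greedy_class m = (THE k. m \<in> range (greedy_seq k))"

end

theory Submission
  imports Defs
begin

text \<open>
  Both sides of the identity follow the same recursion \<open>b 0 = 0\<close>,
  \<open>b (n + 1) = (3 * b n + 2) div 2\<close>.

  For the digits this is almost immediate. Exploding the rightmost box first leaves the digit
  \<open>m mod 3\<close> there and turns the rest of the row into the representation of \<open>2 * (m div 3)\<close>. So,
  for \<open>n \<ge> 1\<close>, \<open>m\<close> has at most \<open>n + 1\<close> digits iff the even number \<open>2 * (m div 3)\<close> has at most \<open>n\<close>.
  If \<open>2 * b\<close> is the largest even number with at most \<open>n\<close> digits, the largest one with at most
  \<open>n + 1\<close> digits is therefore \<open>2 * ((3 * b + 2) div 2)\<close>. Since \<open>b\<close> grows strictly, these maxima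
  have exactly the permitted number of digits.

  For the greedy partition the point is to find the class function in closed form: it is the
  function \<open>c\<close> with \<open>c 0 = 0\<close> and \<open>c (3 * x + i) = (3 * c x + i) div 2\<close> for ternary digits \<open>i\<close>.
  Since \<open>3 ^ (n + 1) - 1 = 3 * (3 ^ n - 1) + 2\<close>, the values \<open>c (3 ^ n - 1)\<close> then satisfy the
  recursion. To see that the level sets of \<open>c\<close> are the greedy sequences it suffices to know
  three things about every \<open>k\<close> (lemma \<open>range_earliest_eqI\<close>): the level set of \<open>k\<close> is infinite,
  it has no 3-term progression, and every \<open>m\<close> with \<open>c m > k\<close> is the last term of a progression
  whose other two terms have class \<open>k\<close>.

  Progression-freeness holds because \<open>c (3 * x + i) = k\<close> leaves only two choices for the pair
  of \<open>c x\<close> and \<open>i\<close>, with distinct digits \<open>i\<close>; the last digits of a 3-term progression are all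
  equal or all distinct, hence here all equal, and one can descend to the leading parts.
  The blocking property is proved by building the two earlier terms digit by digit
  (lemma \<open>completes_if_less\<close>); carries force one to prove it together with two perturbed forms
  of the progression equation.
\<close>

section \<open>Digits in base 3/2\<close>

text \<open>The digit in box \<open>i\<close>, when the boxes are emptied strictly from right to left.\<close>

primrec digit32 :: "nat \<Rightarrow> nat \<Rightarrow> nat" where
  "digit32 m 0 = m mod 3"
| "digit32 m (Suc i) = digit32 (2 * (m div 3)) i"

lemma digit32_0 [simp]: "digit32 0 i = 0"
  by (induction i) auto

lemma digit32_less: "digit32 m i < 3"
  by (induction i arbitrary: m) auto

lemma digit32_conv_case_nat:
  "digit32 m = case_nat (m mod 3) (digit32 (2 * (m div 3)))"
  by (auto simp: fun_eq_iff split: nat.split)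

lemma explode_case_nat:
  assumes "explode c d"
  shows "explode (case_nat a c) (case_nat a d)"
proof -
  from assms obtain i where i: "3 \<le> c i" "d = c(i := c i - 3, Suc i := c (Suc i) + 2)"
    by cases
  have "explode (case_nat a c) ((case_nat a c)(Suc i := case_nat a c (Suc i) - 3,
          Suc (Suc i) := case_nat a c (Suc (Suc i)) + 2))"
    using i(1) by (intro explode.intros) simp
  also have "(case_nat a c)(Suc i := case_nat a c (Suc i) - 3,
          Suc (Suc i) := case_nat a c (Suc (Suc i)) + 2) = case_nat a d"
    by (auto simp: fun_eq_iff i(2) split: nat.split)
  finally show ?thesis .
qed

lemma explode_rtranclp_case_nat:
  assumes "explode\<^sup>*\<^sup>* c d"
  shows "explode\<^sup>*\<^sup>* (case_nat a c) (case_nat a d)"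
  using assms
  by (induction rule: rtranclp_induct) (auto intro: explode_case_nat rtranclp.rtrancl_into_rtrancl)

lemma explode_rightmost_box:
  "explode\<^sup>*\<^sup>* (case_nat (3 * q + r) (initial_boxes s)) (case_nat r (initial_boxes (s + 2 * q)))"
proof (induction q arbitrary: s)
  case (Suc q)
  let ?c = "case_nat (3 * Suc q + r) (initial_boxes s)"
  have "explode ?c (?c(0 := ?c 0 - 3, Suc 0 := ?c (Suc 0) + 2))"
    by (rule explode.intros) simp
  also have "?c(0 := ?c 0 - 3, Suc 0 := ?c (Suc 0) + 2)
      = case_nat (3 * q + r) (initial_boxes (s + 2))"
    by (auto simp: fun_eq_iff initial_boxes_def split: nat.split)
  finally have "explode ?c (case_nat (3 * q + r) (initial_boxes (s + 2)))" .
  moreover have "s + 2 + 2 * q = s + 2 * Suc q" by simp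
  ultimately show ?case using Suc.IH[of "s + 2"] by (metis converse_rtranclp_into_rtranclp)
qed simp

lemma explode_to_digit32: "explode\<^sup>*\<^sup>* (initial_boxes m) (digit32 m)"
proof (induction m rule: less_induct)
  case (less m)
  show ?case
  proof (cases "m = 0")
    case True
    then have "initial_boxes m = digit32 m" by (auto simp: initial_boxes_def)
    then show ?thesis by simp
  next
    case False
    have "initial_boxes m = case_nat (3 * (m div 3) + m mod 3) (initial_boxes 0)"
      by (auto simp: fun_eq_iff initial_boxes_def split: nat.split)
    then have "explode\<^sup>*\<^sup>* (initial_boxes m) (case_nat (m mod 3) (initial_boxes (2 * (m div 3))))"
      using explode_rightmost_box[of "m div 3" "m mod 3" 0] by simp
    moreover have "explode\<^sup>*\<^sup>* (case_nat (m mod 3) (initial_boxes (2 * (m div 3)))) (digit32 m)"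
      using explode_rtranclp_case_nat[OF less, of "2 * (m div 3)" "m mod 3"] False
      by (simp add: digit32_conv_case_nat[of m])
    ultimately show ?thesis by (rule rtranclp_trans)
  qed
qed

lemma final_boxes_eq_digit32: "final_boxes m = digit32 m"
proof -
  have "settled (digit32 m)" unfolding settled_def
  proof
    fix i
    show "digit32 m i \<in> {0, 1, 2}" using digit32_less[of m i] by auto
  qed
  then have "explode\<^sup>*\<^sup>* (initial_boxes m) (digit32 m) \<and> settled (digit32 m)"
    using explode_to_digit32 by blast
  then show ?thesis
    unfolding final_boxes_def using ex1_final_boxes by (intro the1_equality)
qed

section \<open>The largest even number with a given number of digits\<close>

primrec half_largest :: "nat \<Rightarrow> nat" where
  "half_largest 0 = 0"
| "half_largest (Suc n) = (3 * half_largest n + 2) div 2"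

lemma strict_mono_half_largest: "strict_mono half_largest"
  unfolding strict_mono_Suc_iff by auto

lemma even_le_iff: "m \<le> k \<longleftrightarrow> m \<le> 2 * (k div 2)" if "even m" for m k :: nat
proof -
  from that obtain j where "m = 2 * j" by (rule evenE)
  then show ?thesis using less_eq_div_iff_mult_less_eq[of 2 j k] by (simp add: mult.commute)
qed

text \<open>Both sides pass from \<open>m\<close> to \<open>2 * (m div 3)\<close> when \<open>n\<close> decreases by one; that number is
  even, so the induction hypothesis applies to it.\<close>

lemma digits_vanish_iff:
  assumes "even m"
  shows "(\<forall>i\<ge>n. digit32 m i = 0) \<longleftrightarrow> m \<le> 2 * half_largest n"
  using assms
proof (induction n arbitrary: m)
  case 0
  have "m = 0" if "\<forall>i. digit32 m i = 0" for m
    using that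
  proof (induction m rule: less_induct)
    case (less m)
    show ?case
    proof (rule ccontr)
      assume "m \<noteq> 0"
      have mod: "m mod 3 = 0" using less.prems[rule_format, of 0] by simp
      have "\<forall>i. digit32 (2 * (m div 3)) i = 0" using less.prems by (metis digit32.simps(2))
      then have "2 * (m div 3) = 0" using less.IH[of "2 * (m div 3)"] \<open>m \<noteq> 0\<close> by simp
      with mod \<open>m \<noteq> 0\<close> show False by auto
    qed
  qed
  then show ?case by auto
next
  case (Suc n)
  have "(\<forall>i\<ge>Suc n. digit32 m i = 0) \<longleftrightarrow> (\<forall>i\<ge>n. digit32 (2 * (m div 3)) i = 0)"
    by (metis Suc_le_D Suc_le_mono digit32.simps(2))
  also have "\<dots> \<longleftrightarrow> 2 * (m div 3) \<le> 2 * half_largest n"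
    by (rule Suc.IH) simp
  also have "\<dots> \<longleftrightarrow> m \<le> 3 * half_largest n + 2"
    using div_less_iff_less_mult[of 3 m "Suc (half_largest n)"]
    by (simp add: less_Suc_eq_le) auto
  also have "\<dots> \<longleftrightarrow> m \<le> 2 * half_largest (Suc n)"
    using even_le_iff[OF Suc.prems] by (simp only: half_largest.simps)
  finally show ?case .
qed

lemma length_digits32_le_iff:
  assumes "even m" "0 < m"
  shows "length (digits32 m) \<le> n \<longleftrightarrow> m \<le> 2 * half_largest n"
proof -
  let ?S = "{i. digit32 m i \<noteq> 0}"
  have "m \<le> 2 * half_largest m"
    using strict_mono_imp_increasing[OF strict_mono_half_largest, of m] by simp
  then have "\<forall>i\<ge>m. digit32 m i = 0" using digits_vanish_iff assms(1) by blast
  then have "?S \<subseteq> {..<m}" by (auto intro: leI)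
  then have fin: "finite ?S" by (rule finite_subset) simp
  have ne: "?S \<noteq> {}" using digits_vanish_iff[of m 0] assms by auto
  have "length (digits32 m) = Suc (Max ?S)"
    using assms by (simp add: digits32_def final_boxes_eq_digit32 del: upt_Suc)
  then have "length (digits32 m) \<le> n \<longleftrightarrow> (\<forall>i\<in>?S. i < n)"
    using fin ne by (simp add: Suc_le_eq)
  also have "\<dots> \<longleftrightarrow> (\<forall>i\<ge>n. digit32 m i = 0)" by (metis (mono_tags) mem_Collect_eq not_le)
  finally show ?thesis using digits_vanish_iff assms(1) by simp
qed

lemma largest_even_eq:
  assumes "n \<ge> 1"
  shows "largest_even n = 2 * half_largest n"
  unfolding largest_even_def
proof (rule Greatest_equality)
  have less: "half_largest (n - 1) < half_largest n"
    using assms strict_monoD[OF strict_mono_half_largest, of "n - 1" n] by simp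
  then have pos: "0 < 2 * half_largest n" by simp
  have "length (digits32 (2 * half_largest n)) \<le> n"
    "\<not> length (digits32 (2 * half_largest n)) \<le> n - 1"
    using less pos by (simp_all add: length_digits32_le_iff)
  then show "even (2 * half_largest n) \<and> 0 < 2 * half_largest n
      \<and> length (digits32 (2 * half_largest n)) = n"
    using pos by simp
next
  fix m
  assume "even m \<and> 0 < m \<and> length (digits32 m) = n"
  then show "m \<le> 2 * half_largest n" using length_digits32_le_iff by blast
qed

section \<open>Recognising a lexicographically earliest sequence\<close>

text \<open>A set \<open>C\<close> that blocks every other element of \<open>A\<close> is what the greedy choice produces: a
  competitor that falls below the enumeration of \<open>C\<close> for the first time does so with an
  element outside \<open>C\<close>, and the two terms blocking it are smaller, hence were already chosen.\<close>

lemma range_earliest_eqI: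
  assumes "C \<subseteq> A" "infinite C" "ap3_free C"
    and blocked: "\<And>m. m \<in> A - C \<Longrightarrow> \<exists>b d. 0 < d \<and> b \<in> C \<and> b + d \<in> C \<and> m = b + 2 * d"
  shows "range (earliest A) = C"
proof -
  obtain s :: "nat \<Rightarrow> nat" where range: "range s = C" and mono: "strict_mono s"
    by (rule that[OF range_enumerate[OF assms(2)] strict_mono_enumerate[OF assms(2)]])
  have adm: "admissible A s" unfolding admissible_def using mono range assms by simp
  have least: "lex_less s t" if t: "admissible A t" "t \<noteq> s" for t
  proof -
    define i where "i = (LEAST i. t i \<noteq> s i)"
    have "\<exists>i. t i \<noteq> s i" using t(2) by auto
    then have ne: "t i \<noteq> s i" unfolding i_def by (rule LeastI_ex)
    have same: "t j = s j" if "j < i" for j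
      using that not_less_Least unfolding i_def by blast
    have tm: "strict_mono t" and tA: "range t \<subseteq> A" and tfree: "ap3_free (range t)"
      using t(1) unfolding admissible_def by auto
    have "\<not> t i < s i"
    proof
      assume lt: "t i < s i"
      have early: "x \<in> range t" "x \<noteq> t i" if x: "x \<in> C" "x \<le> t i" for x
      proof -
        obtain j where j: "x = s j" using x(1) range by blast
        have "s j < s i" using x(2) lt j by linarith
        then have "j < i" using strict_mono_less[OF mono] by blast
        then have "x = t j" "t j < t i" using j same strict_monoD[OF tm] by (simp, blast)
        then show "x \<in> range t" "x \<noteq> t i" by simp_all
      qed
      have "t i \<in> A - C" using early(2) tA by blast
      then obtain b d where bd: "0 < d" "b \<in> C" "b + d \<in> C" "t i = b + 2 * d"
        using blocked by blast
      then have "b \<in> range t" "b + d \<in> range t" "b + 2 * d \<in> range t"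
        using early(1)[of b] early(1)[of "b + d"] rangeI[of t i] by auto
      with tfree bd(1) show False unfolding ap3_free_def by blast
    qed
    with ne same show ?thesis unfolding lex_less_def by (metis linorder_neqE_nat)
  qed
  have "earliest A = s"
    unfolding earliest_def
  proof (rule the_equality)
    show "admissible A s \<and> (\<forall>t. admissible A t \<and> t \<noteq> s \<longrightarrow> lex_less s t)"
      using adm least by simp
    show "t = s" if "admissible A t \<and> (\<forall>u. admissible A u \<and> u \<noteq> t \<longrightarrow> lex_less t u)" for t
      using that adm least lex_less_antisym by metis
  qed
  then show ?thesis using range by simp
qed

section \<open>A ternary recursion for the class function\<close>

fun ternary_class :: "nat \<Rightarrow> nat" where
  "ternary_class m = (if m = 0 then 0 else (3 * ternary_class (m div 3) + m mod 3) div 2)"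

declare ternary_class.simps [simp del]

lemma ternary_class_0 [simp]: "ternary_class 0 = 0"
  by (simp add: ternary_class.simps)

lemma ternary_class_digit:
  assumes "i < 3"
  shows "ternary_class (3 * x + i) = (3 * ternary_class x + i) div 2"
  using assms by (cases "3 * x + i = 0") (simp_all add: ternary_class.simps[of "3 * x + i"])

lemma ternary_class_repunit2: "ternary_class (3 ^ n - 1) = half_largest n"
proof (induction n)
  case (Suc n)
  have "3 ^ Suc n - 1 = 3 * (3 ^ n - 1) + (2 :: nat)"
    using one_le_power[of "3 :: nat" n] unfolding power_Suc by linarith
  then have "ternary_class (3 ^ Suc n - 1) = (3 * ternary_class (3 ^ n - 1) + 2) div 2"
    using ternary_class_digit[of 2 "3 ^ n - 1"] by simp
  then show ?case by (simp only: Suc.IH half_largest.simps)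
qed simp

text \<open>A member of the smaller class \<open>2 * k div 3\<close>, extended by the digit \<open>2 * k mod 3\<close>, has class
  \<open>k\<close>. This does not decrease the class for \<open>k = 0\<close>; there the powers of 3 serve.\<close>

lemma ternary_class_unbounded: "\<exists>x\<ge>N. ternary_class x = k"
proof (induction k rule: less_induct)
  case (less k)
  show ?case
  proof (cases "k = 0")
    case True
    have "ternary_class (3 ^ j) = 0" for j
    proof (induction j)
      case 0
      show ?case by (simp add: ternary_class.simps)
    next
      case (Suc j)
      then show ?case using ternary_class_digit[of 0 "3 ^ j"] by simp
    qed
    moreover have "N \<le> 3 ^ N" using power_gt_expt[of 3 N] by simp
    ultimately show ?thesis using True by blast
  next
    case False
    then have "2 * k div 3 < k" by simp
    then obtain x where x: "x \<ge> N" "ternary_class x = 2 * k div 3" using less.IH by blast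
    have "ternary_class (3 * x + 2 * k mod 3) = k"
      using x(2) by (simp add: ternary_class_digit)
    moreover have "N \<le> 3 * x + 2 * k mod 3" using x(1) by simp
    ultimately show ?thesis by blast
  qed
qed

lemma infinite_ternary_class: "infinite {m. ternary_class m = k}"
  unfolding infinite_nat_iff_unbounded_le using ternary_class_unbounded by auto

section \<open>Classes contain no 3-term progression\<close>

text \<open>From \<open>(3 * a + i) div 2 = k\<close> the number \<open>3 * a + i\<close> is \<open>2 * k\<close> or \<open>2 * k + 1\<close>. Three
  last digits in progression modulo 3 that take at most two values must coincide, and the
  common digit determines \<open>a\<close>.\<close>

lemma digits_of_progression_in_class:
  fixes a b c i j l k :: nat
  assumes "i < 3" "j < 3" "l < 3" "(i + l) mod 3 = (2 * j) mod 3"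
    and "(3 * a + i) div 2 = k" "(3 * b + j) div 2 = k" "(3 * c + l) div 2 = k"
  shows "i = j \<and> l = j \<and> a = b \<and> c = b"
proof -
  have "3 * a + i = 2 * k \<or> 3 * a + i = 2 * k + 1"
    and "3 * b + j = 2 * k \<or> 3 * b + j = 2 * k + 1"
    and "3 * c + l = 2 * k \<or> 3 * c + l = 2 * k + 1"
    using assms(5-7) by auto
  moreover have "u = v" if "u < 3" "v < 3" "3 * e + u = 3 * f + v" for u v e f :: nat
    using that by presburger
  ultimately have "i = j \<or> j = l \<or> i = l" using assms(1-3) by metis
  moreover have "i = 0 \<or> i = 1 \<or> i = 2" "j = 0 \<or> j = 1 \<or> j = 2" "l = 0 \<or> l = 1 \<or> l = 2"
    using assms(1-3) by auto
  ultimately have digits: "i = j" "l = j" using assms(4) by auto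
  moreover have "e = f" if "(3 * e + j) div 2 = k" "(3 * f + j) div 2 = k" for e f
    using that by linarith
  ultimately show ?thesis using assms(5-7) by blast
qed

lemma no_progression_in_class:
  assumes "x + z = 2 * y" "ternary_class x = k" "ternary_class y = k" "ternary_class z = k"
  shows "x = y"
  using assms
proof (induction "x + z" arbitrary: x y z k rule: less_induct)
  case less
  show ?case
  proof (cases "x + z = 0")
    case False
    have split: "u = 3 * (u div 3) + u mod 3" for u :: nat by simp
    have step: "(3 * ternary_class (u div 3) + u mod 3) div 2 = ternary_class u" for u
      using ternary_class_digit[of "u mod 3" "u div 3"] by simp
    have "(x mod 3 + z mod 3) mod 3 = (2 * (y mod 3)) mod 3"
      using less.prems(1) by (metis mod_add_eq mod_mult_right_eq)
    from digits_of_progression_in_class[OF _ _ _ this, of "ternary_class (x div 3)" k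
        "ternary_class (y div 3)" "ternary_class (z div 3)"]
    have eq: "x mod 3 = y mod 3" "z mod 3 = y mod 3"
      "ternary_class (x div 3) = ternary_class (y div 3)"
      "ternary_class (z div 3) = ternary_class (y div 3)"
      using less.prems(2-4) step by auto
    have "x div 3 + z div 3 = 2 * (y div 3)"
      using eq(1,2) less.prems(1) split[of x] split[of y] split[of z] by linarith
    moreover have "x div 3 + z div 3 < x + z" using False by linarith
    ultimately have "x div 3 = y div 3" using less.hyps eq(3,4) by blast
    with eq(1) show ?thesis using split by metis
  qed (use less.prems(1) in simp)
qed

lemma ap3_free_ternary_class: "ap3_free {m. ternary_class m = k}"
proof -
  have False if "0 < d" "ternary_class b = k" "ternary_class (b + d) = k"
    "ternary_class (b + 2 * d) = k" for b d
    using no_progression_in_class[of b "b + 2 * d" "b + d" k] that by simp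
  then show ?thesis unfolding ap3_free_def by blast
qed

section \<open>Later classes are blocked by earlier ones\<close>

text \<open>For \<open>e = 0\<close> and \<open>a = b = k\<close> this says that \<open>m\<close> ends a nonconstant progression with two
  earlier terms in class \<open>k\<close>. Appending ternary digits \<open>i\<close>, \<open>j\<close>, \<open>l\<close> to \<open>x\<close>, \<open>y\<close>, \<open>m\<close>
  creates carries; the offset \<open>e\<close> records them.\<close>

definition completes :: "nat \<Rightarrow> nat \<Rightarrow> nat \<Rightarrow> int \<Rightarrow> bool" where
  "completes m a b e \<longleftrightarrow> (\<exists>x y. x < m \<and> ternary_class x = a \<and> ternary_class y = b
     \<and> int x + int m + e = 2 * int y)"

lemma completes_append_digits:
  assumes "completes m a b e" "i < 3" "j < 3"
    and "(3 * a + i) div 2 = a'" "(3 * b + j) div 2 = b'" "3 * e + 2 * int j = int (i + l) + e'"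
  shows "completes (3 * m + l) a' b' e'"
proof -
  from assms(1) obtain x y where xy: "x < m" "ternary_class x = a" "ternary_class y = b"
      "int x + int m + e = 2 * int y"
    unfolding completes_def by blast
  have "3 * x + i < 3 * m + l" using xy(1) assms(2) by linarith
  moreover have "ternary_class (3 * x + i) = a'" "ternary_class (3 * y + j) = b'"
    using xy(2,3) assms by (simp_all add: ternary_class_digit)
  moreover have "int (3 * x + i) + int (3 * m + l) + e' = 2 * int (3 * y + j)"
    using xy(4) assms(6) by simp
  ultimately show ?thesis unfolding completes_def by blast
qed

text \<open>When \<open>m\<close> itself has class \<open>a\<close>, the degenerate progression \<open>x = y = m\<close> can be extended, as
  long as the appended digits put the first term below the last one.\<close>

lemma completes_append_digits_weak:
  assumes "a < ternary_class m \<Longrightarrow> completes m a a 0" "a \<le> ternary_class m"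
    and "i < l" "l < 3" "j < 3"
    and "(3 * a + i) div 2 = a'" "(3 * a + j) div 2 = b'" "2 * int j = int (i + l) + e'"
  shows "completes (3 * m + l) a' b' e'"
proof (cases "a = ternary_class m")
  case True
  have "ternary_class (3 * m + i) = a'" "ternary_class (3 * m + j) = b'"
    using True assms(3-7) by (simp_all add: ternary_class_digit)
  moreover have "int (3 * m + i) + int (3 * m + l) + e' = 2 * int (3 * m + j)"
    using assms(8) by simp
  moreover have "3 * m + i < 3 * m + l" using assms(3) by simp
  ultimately show ?thesis unfolding completes_def by blast
next
  case False
  then have "completes m a a 0" using assms(1,2) by simp
  then show ?thesis using assms(3-8) by (elim completes_append_digits) auto
qed

text \<open>The last digits \<open>i\<close>, \<open>j\<close>, \<open>l\<close> of \<open>x\<close>, \<open>y\<close>, \<open>m\<close> must satisfy \<open>i + l + e = 2 * j\<close> modulo 3, and the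
  prescribed classes restrict \<open>i\<close> and \<open>j\<close> to two values each. For every digit \<open>l\<close> and residue of
  \<open>p\<close> modulo 3 this leaves a choice that reduces to such a problem for the leading
  parts, or to the degenerate one solved by \<open>x = y\<close>. Take
  \<open>p = 3 * s + 1\<close> and \<open>l = 1\<close> in the unperturbed equation: class \<open>p\<close> arises from class \<open>2 * s\<close>
  by appending 2 and from class \<open>2 * s + 1\<close> by appending 0. Equal digits violate the congruence;
  \<open>i = 2\<close>, \<open>j = 0\<close> satisfies it with a carry, so that the leading parts need offset 1 and
  neighbouring classes. The conjunction below is closed under this descent.\<close>

lemma completes_if_less:
  assumes "p < ternary_class m"
  shows "completes m p p 0 \<and> completes m p p (-1) \<and> completes m p (p + 1) 1"
  using assms
proof (induction m arbitrary: p rule: less_induct)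
  case (less m)
  define n l where "n = m div 3" and "l = m mod 3"
  have "m \<noteq> 0" using less.prems by (metis not_less_zero ternary_class_0)
  then have "n < m" unfolding n_def by simp
  note IH = less.IH[OF this]
  have m: "m = 3 * n + l" and l: "l < 3" unfolding n_def l_def by simp_all
  have p: "2 * p + 2 \<le> 3 * ternary_class n + l"
    using less.prems ternary_class_digit[OF l, of n] unfolding m by simp
  have same: "completes n q q 0" and less1: "completes n q q (-1)"
    and next1: "completes n q (q + 1) 1" if "q < ternary_class n" for q
    using IH[OF that] by auto
  note strict = completes_append_digits[where m = n and l = l, folded m]
  have weak: "completes m a' b' e'" if "a \<le> ternary_class n" "i < l" "j < 3"
    "(3 * a + i) div 2 = a'" "(3 * a + j) div 2 = b'" "2 * int j = int (i + l) + e'" for a i j a' b' e'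
    unfolding m using same that l by (intro completes_append_digits_weak[where a = a]) auto
  have "p = 3 * (p div 3) + p mod 3" by simp
  moreover have "p mod 3 = 0 \<or> p mod 3 = 1 \<or> p mod 3 = 2" by auto
  ultimately obtain s where "p = 3 * s \<or> p = 3 * s + 1 \<or> p = 3 * s + 2" by (metis add_0_right)
  moreover have l_cases: "l = 0 \<or> l = 1 \<or> l = 2" using l by auto
  ultimately consider "p = 3 * s" "l = 0" | "p = 3 * s" "l = 1" | "p = 3 * s" "l = 2"
    | "p = 3 * s + 1" "l = 0" | "p = 3 * s + 1" "l = 1" | "p = 3 * s + 1" "l = 2"
    | "p = 3 * s + 2" "l = 0" | "p = 3 * s + 2" "l = 1" | "p = 3 * s + 2" "l = 2"
    using l_cases by blast
  then show ?case
    \<comment> \<open>The two numbers after each \<open>of\<close> are the digits appended to \<open>x\<close> and \<open>y\<close>. The degenerate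
      progression is used exactly where \<open>n\<close> may itself have the class that is needed.\<close>
  proof cases
    case 1
    with p have q: "2 * s < ternary_class n" by linarith
    show ?thesis
    proof (intro conjI)
      show "completes m p p 0" by (rule strict[OF same[OF q], of 0 0]) (use 1 in auto)
      show "completes m p p (-1)" by (rule strict[OF less1[OF q], of 0 1]) (use 1 in auto)
      show "completes m p (p + 1) 1" by (rule strict[OF less1[OF q], of 0 2]) (use 1 in auto)
    qed
  next
    case 2
    with p have q: "2 * s < ternary_class n" by linarith
    show ?thesis
    proof (intro conjI)
      show "completes m p p 0" by (rule strict[OF same[OF q], of 1 1]) (use 2 in auto)
      show "completes m p p (-1)" by (rule strict[OF same[OF q], of 0 0]) (use 2 in auto)
      show "completes m p (p + 1) 1" by (rule strict[OF next1[OF q], of 1 0]) (use 2 in auto)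
    qed
  next
    case 3
    with p have q: "2 * s \<le> ternary_class n" by linarith
    show ?thesis
    proof (intro conjI)
      show "completes m p p 0" by (rule weak[OF q, of 0 1]) (use 3 in auto)
      show "completes m p p (-1)" by (rule weak[OF q, of 1 1]) (use 3 in auto)
      show "completes m p (p + 1) 1" by (rule weak[OF q, of 1 2]) (use 3 in auto)
    qed
  next
    case 4
    with p have q: "2 * s < ternary_class n" "2 * s + 1 < ternary_class n" by linarith+
    show ?thesis
    proof (intro conjI)
      show "completes m p p 0" by (rule strict[OF same[OF q(2)], of 0 0]) (use 4 in auto)
      show "completes m p p (-1)" by (rule strict[OF less1[OF q(1)], of 2 2]) (use 4 in auto)
      show "completes m p (p + 1) 1" by (rule strict[OF less1[OF q(2)], of 0 2]) (use 4 in auto)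
    qed
  next
    case 5
    with p have q: "2 * s < ternary_class n" "2 * s + 1 \<le> ternary_class n" by linarith+
    show ?thesis
    proof (intro conjI)
      show "completes m p p 0" by (rule strict[OF next1[OF q(1)], of 2 0]) (use 5 in auto)
      show "completes m p p (-1)" by (rule weak[OF q(2), of 0 0]) (use 5 in auto)
      show "completes m p (p + 1) 1" by (rule weak[OF q(2), of 0 1]) (use 5 in auto)
    qed
  next
    case 6
    with p have q: "2 * s < ternary_class n" by linarith
    show ?thesis
    proof (intro conjI)
      show "completes m p p 0" by (rule strict[OF same[OF q], of 2 2]) (use 6 in auto)
      show "completes m p p (-1)" by (rule strict[OF next1[OF q], of 2 0]) (use 6 in auto)
      show "completes m p (p + 1) 1" by (rule strict[OF next1[OF q], of 2 1]) (use 6 in auto)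
    qed
  next
    case 7
    with p have q: "2 * s + 1 < ternary_class n" by linarith
    show ?thesis
    proof (intro conjI)
      show "completes m p p 0" by (rule strict[OF less1[OF q], of 1 2]) (use 7 in auto)
      show "completes m p p (-1)" by (rule strict[OF less1[OF q], of 2 2]) (use 7 in auto)
      show "completes m p (p + 1) 1" by (rule strict[OF next1[OF q], of 2 0]) (use 7 in auto)
    qed
  next
    case 8
    with p have q: "2 * s + 1 < ternary_class n" by linarith
    show ?thesis
    proof (intro conjI)
      show "completes m p p 0" by (rule strict[OF same[OF q], of 1 1]) (use 8 in auto)
      show "completes m p p (-1)" by (rule strict[OF less1[OF q], of 1 2]) (use 8 in auto)
      show "completes m p (p + 1) 1" by (rule strict[OF next1[OF q], of 1 0]) (use 8 in auto)
    qed
  next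
    case 9
    with p have q: "2 * s + 1 < ternary_class n" by linarith
    show ?thesis
    proof (intro conjI)
      show "completes m p p 0" by (rule strict[OF same[OF q], of 2 2]) (use 9 in auto)
      show "completes m p p (-1)" by (rule strict[OF same[OF q], of 1 1]) (use 9 in auto)
      show "completes m p (p + 1) 1" by (rule strict[OF next1[OF q], of 2 1]) (use 9 in auto)
    qed
  qed
qed

lemma blocked_by_earlier_class:
  assumes "k < ternary_class m"
  shows "\<exists>b d. 0 < d \<and> ternary_class b = k \<and> ternary_class (b + d) = k \<and> m = b + 2 * d"
proof -
  from completes_if_less[OF assms] obtain x y where xy: "x < m" "ternary_class x = k"
      "ternary_class y = k" "int x + int m = 2 * int y"
    unfolding completes_def by auto
  then have "x < y" "y = x + (y - x)" "m = x + 2 * (y - x)" by linarith+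
  with xy show ?thesis by (metis zero_less_diff)
qed

section \<open>The greedy partition\<close>

lemma range_earliest_ternary_class:
  "range (earliest (- {m. ternary_class m < k})) = {m. ternary_class m = k}"
proof (rule range_earliest_eqI[OF _ infinite_ternary_class ap3_free_ternary_class])
  fix m
  assume "m \<in> - {m. ternary_class m < k} - {m. ternary_class m = k}"
  then have "k < ternary_class m" by auto
  from blocked_by_earlier_class[OF this]
  show "\<exists>b d. 0 < d \<and> b \<in> {m. ternary_class m = k} \<and> b + d \<in> {m. ternary_class m = k}
      \<and> m = b + 2 * d" by simp
qed auto

lemma used_eq: "used k = {m. ternary_class m < k}"
  by (induction k) (auto simp: range_earliest_ternary_class less_Suc_eq)

lemma greedy_class_eq: "greedy_class m = ternary_class m"
  by (simp add: greedy_class_def greedy_seq_def used_eq range_earliest_ternary_class)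

theorem lemma8:
  fixes n :: nat
  assumes "n \<ge> 1"
  shows "largest_even n = 2 * greedy_class (3 ^ n - 1)"
  using assms by (simp add: largest_even_eq greedy_class_eq ternary_class_repunit2 del: One_nat_def)

end
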